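(* Let $(X,\mathcal F)$ be a compact Polish foliated space. Let $\overline L$ be a compactification of a leaf $L$ (with the leaf topology), with corona $\partial L=\overline L\setminus L$. If $\overline L\le L^\nu$, where $L^\nu$ is the Higson compactification of $L$, then the limit set $\lim_{\mathbf e}L$ is $\mathcal F$-saturated for all $\mathbf e\in\partial L$.
   Context: Foliated spaces. A (topological) foliated structure $\mathcal F$ of dimension $n$ on a space $X$ is given by an atlas $\{(U_i,\phi_i)\}$, where $\{U_i\}$ is an open cover of $X$ and $\phi_i:U_i\to B_i\times Z_i$ are homeomorphisms, with $B_i\subset\mathbb R^n$ an open ball and $Z_i$ a locally compact Polish space, whose changes of coordinates are locally of the form $\phi_j\phi_i^{-1}(x,z)=(x_{ij}(x,z),h_{ij}(z))$. The sets $\phi_i^{-1}(B_i\times\{z\})$ are the plaques; the leaves are the connected components of $X$ with the (leaf) topology whose basic open sets are the plaques of all foliated charts. $(X,\mathcal F)$ is a compact Polish foliated space if $X$ is compact, Hausdorff and second countable. A subset of $X$ is $\mathcal F$-saturated if it is a union of leaves. Leaf metrics. A foliated atlas $\mathcal U=\{(U_i,\phi_i)\}$ is regular if: each $(U_i,\phi_i)$ is the restriction of a foliated chart $(\widetilde U_i,\tilde\phi_i)$ with $\overline{U_i}\subset\widetilde U_i$; $\{U_i\}$ is locally finite; and the closure of every plaque of $(U_i,\phi_i)$ meets at most the closure of one plaque of $(U_j,\phi_j)$, for all $i,j$. Fix a regular foliated atlas $\mathcal U$. For $x,y$ in the same leaf, $d^*_{\mathcal U}(x,y)=0$ if $x=y$,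 and otherwise it is the minimum number of $\mathcal U$-plaques whose union is connected and contains $x$ and $y$. Compactifications. A compactification of $L$ is a compact Hausdorff space $\overline L$ containing $L$ (with the leaf topology) as a dense subspace; $L$ is then open in $\overline L$. For two compactifications, $\overline L\le\overline L'$ means that $\mathrm{id}_L$ has a continuous extension $\overline L'\to\overline L$. Higson compactification. A function on $L$ vanishes at infinity if for every $\epsilon>0$ its absolute value is $<\epsilon$ outside some compact subset of $L$. For $f:L\to\mathbb C$ and $R>0$, $\mathsf V_Rf(x)=\sup\{|f(x)-f(y)|\mid y\in L,\ d^*_{\mathcal U}(x,y)<R\}$. A bounded function $f$ is a Higson function if $\mathsf V_Rf$ vanishes at infinity for all $R>0$. The Higson compactification $L^\nu$ is the compactification of $L$ corresponding (by Gelfand duality) to the unital closed involutive algebra of bounded Higson functions on $L$ that are continuous for the leaf topology; i.e., these are exactly the functions on $L$ with a continuous extension to $L^\nu$. It is independent of $\mathcal U$. Limit sets. For $\mathbf e\in\partial L$, $\lim_{\mathbf e}L=\bigcap_V\mathrm{Cl}_X(V\cap L)$, where $V$ runs in the collection of neighborhoods of $\mathbf e$ in $\overline L$ and $\mathrm{Cl}_X$ is the closure in $X$. *)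

theory Defs
  imports "HOL-Analysis.Analysis"
begin

section \<open>Foliated spaces\<close>

definition Euclidean_open_ball :: "nat \<Rightarrow> (nat \<Rightarrow> real) set \<Rightarrow> bool" where
  "Euclidean_open_ball n B \<longleftrightarrow>
     (\<exists>c\<in>topspace (Euclidean_space n). \<exists>r>0.
        B = {x \<in> topspace (Euclidean_space n). L2_set (\<lambda>i. x i - c i) {..<n} < r})"

definition locally_compact_Polish_space :: "'z topology \<Rightarrow> bool" where
  "locally_compact_Polish_space Z \<longleftrightarrow>
     locally_compact_space Z \<and> completely_metrizable_space Z \<and> separable_space Z"

text \<open>
  The data of a chart \<open>\<phi> : U \<rightarrow> B \<times> Z\<close>. The map is a total function, whose values off \<open>U\<close> are
  never used. The type \<open>'z\<close> of points of the local transversals is a parameter.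
\<close>

record ('a, 'z) fol_chart =
  cdom :: "'a set"
  cball :: "(nat \<Rightarrow> real) set"
  ctrans :: "'z topology"
  cmap :: "'a \<Rightarrow> (nat \<Rightarrow> real) \<times> 'z"

definition is_chart :: "nat \<Rightarrow> 'a topology \<Rightarrow> ('a, 'z) fol_chart \<Rightarrow> bool" where
  "is_chart n X c \<longleftrightarrow>
     openin X (cdom c) \<and> Euclidean_open_ball n (cball c) \<and>
     locally_compact_Polish_space (ctrans c) \<and>
     homeomorphic_map (subtopology X (cdom c))
       (prod_topology (subtopology (Euclidean_space n) (cball c)) (ctrans c)) (cmap c)"

text \<open>
  The change of coordinates is locally of the form \<open>(x, z) \<mapsto> (x'(x, z), h(z))\<close>. Since it is a
  homeomorphism between open sets, continuity of \<open>x'\<close>, and of \<open>h\<close> on small product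
  neighborhoods, is automatic.
\<close>

definition coord_change_ok ::
    "'a topology \<Rightarrow> ('a, 'z) fol_chart \<Rightarrow> ('a, 'z) fol_chart \<Rightarrow> bool" where
  "coord_change_ok X c c' \<longleftrightarrow>
     (\<forall>p \<in> cdom c \<inter> cdom c'. \<exists>W x' h.
        openin X W \<and> p \<in> W \<and> W \<subseteq> cdom c \<inter> cdom c' \<and>
        (\<forall>q\<in>W. \<forall>x z. cmap c q = (x, z) \<longrightarrow> cmap c' q = (x' (x, z), h z)))"

definition foliated_atlas :: "nat \<Rightarrow> 'a topology \<Rightarrow> ('a, 'z) fol_chart set \<Rightarrow> bool" where
  "foliated_atlas n X A \<longleftrightarrow>
     (\<forall>c\<in>A. is_chart n X c) \<and> (\<Union>c\<in>A. cdom c) = topspace X \<and>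
     (\<forall>c\<in>A. \<forall>c'\<in>A. coord_change_ok X c c')"

text \<open>
  An atlas \<open>F\<close> stands for the foliated structure that it determines, whose foliated charts are all
  the charts compatible with those of \<open>F\<close>.
\<close>

definition foliated_charts ::
    "nat \<Rightarrow> 'a topology \<Rightarrow> ('a, 'z) fol_chart set \<Rightarrow> ('a, 'z) fol_chart set" where
  "foliated_charts n X F =
     {c. is_chart n X c \<and> (\<forall>a\<in>F. coord_change_ok X c a \<and> coord_change_ok X a c)}"

definition compact_Polish_foliated_space ::
    "nat \<Rightarrow> 'a topology \<Rightarrow> ('a, 'z) fol_chart set \<Rightarrow> bool" where
  "compact_Polish_foliated_space n X F \<longleftrightarrow>
     compact_space X \<and> Hausdorff_space X \<and> second_countable X \<and> foliated_atlas n X F"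

definition chart_plaques :: "('a, 'z) fol_chart \<Rightarrow> 'a set set" where
  "chart_plaques c =
     {{q \<in> cdom c. cmap c q \<in> cball c \<times> {z}} | z. z \<in> topspace (ctrans c)}"

definition leaf_topology :: "nat \<Rightarrow> 'a topology \<Rightarrow> ('a, 'z) fol_chart set \<Rightarrow> 'a topology" where
  "leaf_topology n X F =
     topology_generated_by (\<Union>c \<in> foliated_charts n X F. chart_plaques c)"

definition leaves :: "nat \<Rightarrow> 'a topology \<Rightarrow> ('a, 'z) fol_chart set \<Rightarrow> 'a set set" where
  "leaves n X F = connected_components_of (leaf_topology n X F)"

definition leaf_space ::
    "nat \<Rightarrow> 'a topology \<Rightarrow> ('a, 'z) fol_chart set \<Rightarrow> 'a set \<Rightarrow> 'a topology" where
  "leaf_space n X F L = subtopology (leaf_topology n X F) L"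

definition saturated :: "nat \<Rightarrow> 'a topology \<Rightarrow> ('a, 'z) fol_chart set \<Rightarrow> 'a set \<Rightarrow> bool" where
  "saturated n X F S \<longleftrightarrow> (\<exists>\<L> \<subseteq> leaves n X F. S = \<Union>\<L>)"


section \<open>Regular atlases and the leafwise plaque metric\<close>

text \<open>
  When \<open>c\<close> and \<open>c'\<close> are charts, agreement of the maps forces the ball and the transversal of \<open>c\<close>
  to be subspaces of those of \<open>c'\<close> (if the domain of \<open>c\<close> is nonempty).
\<close>

definition chart_restriction :: "('a, 'z) fol_chart \<Rightarrow> ('a, 'z) fol_chart \<Rightarrow> bool" where
  "chart_restriction c c' \<longleftrightarrow> cdom c \<subseteq> cdom c' \<and> (\<forall>q\<in>cdom c. cmap c q = cmap c' q)"

definition regular_foliated_atlas ::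
    "nat \<Rightarrow> 'a topology \<Rightarrow> ('a, 'z) fol_chart set \<Rightarrow> ('a, 'z) fol_chart set \<Rightarrow> bool" where
  "regular_foliated_atlas n X F \<U> \<longleftrightarrow>
     foliated_atlas n X \<U> \<and> \<U> \<subseteq> foliated_charts n X F \<and>
     (\<forall>c\<in>\<U>. \<exists>c'\<in>foliated_charts n X F.
        chart_restriction c c' \<and> X closure_of (cdom c) \<subseteq> cdom c') \<and>
     (\<forall>x\<in>topspace X. \<exists>V. openin X V \<and> x \<in> V \<and> finite {c\<in>\<U>. cdom c \<inter> V \<noteq> {}}) \<and>
     (\<forall>c\<in>\<U>. \<forall>c'\<in>\<U>. \<forall>P\<in>chart_plaques c. \<forall>Q\<in>chart_plaques c'. \<forall>Q'\<in>chart_plaques c'.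
        X closure_of P \<inter> X closure_of Q \<noteq> {} \<and> X closure_of P \<inter> X closure_of Q' \<noteq> {}
          \<longrightarrow> Q = Q')"

text \<open>
  Only meaningful for points in the same leaf, where a chain of plaques exists. Connectedness is
  understood in the leaf topology.
\<close>

definition plaque_dist ::
    "nat \<Rightarrow> 'a topology \<Rightarrow> ('a, 'z) fol_chart set \<Rightarrow> ('a, 'z) fol_chart set \<Rightarrow> 'a \<Rightarrow> 'a \<Rightarrow> nat" where
  "plaque_dist n X F \<U> x y =
     (if x = y then 0
      else LEAST k. \<exists>\<P> \<subseteq> (\<Union>c\<in>\<U>. chart_plaques c). finite \<P> \<and> card \<P> = k \<and>
             connectedin (leaf_topology n X F) (\<Union>\<P>) \<and> x \<in> \<Union>\<P> \<and> y \<in> \<Union>\<P>)"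


section \<open>Compactifications\<close>

text \<open>
  A compactification of \<open>T\<close> is a space \<open>K\<close> together with an embedding \<open>i\<close> of \<open>T\<close> in \<open>K\<close>, along which
  \<open>T\<close> is regarded as a subspace of \<open>K\<close>.
\<close>

definition compactification :: "'a topology \<Rightarrow> 'k topology \<Rightarrow> ('a \<Rightarrow> 'k) \<Rightarrow> bool" where
  "compactification T K i \<longleftrightarrow>
     compact_space K \<and> Hausdorff_space K \<and> embedding_map T K i \<and>
     K closure_of (i ` topspace T) = topspace K"

definition corona :: "'a topology \<Rightarrow> 'k topology \<Rightarrow> ('a \<Rightarrow> 'k) \<Rightarrow> 'k set" where
  "corona T K i = topspace K - i ` topspace T"

definition compactification_le ::
    "'a topology \<Rightarrow> 'k topology \<Rightarrow> ('a \<Rightarrow> 'k) \<Rightarrow> 'm topology \<Rightarrow> ('a \<Rightarrow> 'm) \<Rightarrow> bool" where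
  "compactification_le T K i K' i' \<longleftrightarrow>
     (\<exists>\<pi>. continuous_map K' K \<pi> \<and> (\<forall>x\<in>topspace T. \<pi> (i' x) = i x))"

definition vanishes_at_infinity :: "'a topology \<Rightarrow> ('a \<Rightarrow> real) \<Rightarrow> bool" where
  "vanishes_at_infinity T f \<longleftrightarrow>
     (\<forall>\<epsilon>>0. \<exists>C. compactin T C \<and> (\<forall>x \<in> topspace T - C. \<bar>f x\<bar> < \<epsilon>))"

text \<open>
  For the bounded functions considered below, the supremum is over a nonempty bounded set.
\<close>

definition variation ::
    "'a set \<Rightarrow> ('a \<Rightarrow> 'a \<Rightarrow> nat) \<Rightarrow> real \<Rightarrow> ('a \<Rightarrow> complex) \<Rightarrow> 'a \<Rightarrow> real" where
  "variation L d R f x = (SUP y \<in> {y \<in> L. real (d x y) < R}. cmod (f x - f y))"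

definition Higson_function :: "'a topology \<Rightarrow> ('a \<Rightarrow> 'a \<Rightarrow> nat) \<Rightarrow> ('a \<Rightarrow> complex) \<Rightarrow> bool" where
  "Higson_function T d f \<longleftrightarrow>
     bounded (f ` topspace T) \<and>
     (\<forall>R>0. vanishes_at_infinity T (variation (topspace T) d R f))"

text \<open>
  A compactification is determined, up to a unique homeomorphism that is the identity on \<open>T\<close>, by
  the algebra of functions on \<open>T\<close> that extend continuously to it. Any compactification whose
  algebra is that of the continuous bounded Higson functions is a model of the Higson
  compactification.
\<close>

definition Higson_compactification ::
    "'a topology \<Rightarrow> ('a \<Rightarrow> 'a \<Rightarrow> nat) \<Rightarrow> 'm topology \<Rightarrow> ('a \<Rightarrow> 'm) \<Rightarrow> bool" where
  "Higson_compactification T d N j \<longleftrightarrow>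
     compactification T N j \<and>
     (\<forall>f :: 'a \<Rightarrow> complex.
        (\<exists>g. continuous_map N euclidean g \<and> (\<forall>x\<in>topspace T. g (j x) = f x)) \<longleftrightarrow>
        continuous_map T euclidean f \<and> Higson_function T d f)"


section \<open>Limit sets\<close>

text \<open>
  The neighborhoods \<open>V\<close> of \<open>e\<close> are not required to be open, and \<open>V \<inter> L\<close> is the preimage of \<open>V\<close>
  under the embedding \<open>i\<close> of \<open>L\<close>.
\<close>

definition limit_set ::
    "'a topology \<Rightarrow> 'a set \<Rightarrow> 'k topology \<Rightarrow> ('a \<Rightarrow> 'k) \<Rightarrow> 'k \<Rightarrow> 'a set" where
  "limit_set X L K i e =
     (\<Inter>V \<in> {V. V \<subseteq> topspace K \<and> (\<exists>W. openin K W \<and> e \<in> W \<and> W \<subseteq> V)}.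
        X closure_of {x \<in> L. i x \<in> V})"

end

theory Submission
  imports Defs
begin

text \<open>
  Plaques are connected in the leaf topology, so two points of a plaque of \<open>\<U>\<close> are at plaque
  distance at most 1. Let \<open>f\<close> be continuous on \<open>K\<close>, with \<open>f e = 0\<close> and \<open>f = 1\<close> off a given
  neighborhood of \<open>e\<close>. As \<open>K \<le> L\<^sup>\<nu>\<close>, its restriction to \<open>L\<close> is a Higson function, so it varies
  by less than \<open>1/2\<close> on each plaque through a point outside some compact \<open>C \<subseteq> L\<close>. If a plaque of
  a chart contains a point \<open>p\<close> of the limit set and a point \<open>q\<close>, then points of \<open>L - C\<close> near \<open>p\<close>
  with \<open>f < 1/2\<close> can be moved inside their plaques to points near \<open>q\<close>, where \<open>f < 1\<close>; hence \<open>q\<close>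
  is in the limit set. The limit set and its complement are thus unions of plaques, and the limit
  set is clopen in the leaf topology.
\<close>

section \<open>Connectedness of balls in \<open>Euclidean_space n\<close>\<close>

lemma connectedin_Euclidean_open_ball:
  assumes "Euclidean_open_ball n B"
  shows "connectedin (Euclidean_space n) B"
proof -
  obtain c r where c: "c \<in> topspace (Euclidean_space n)" "r > 0"
    and B: "B = {x \<in> topspace (Euclidean_space n). L2_set (\<lambda>i. x i - c i) {..<n} < r}"
    using assms unfolding Euclidean_open_ball_def by blast
  have "\<exists>S. connectedin (Euclidean_space n) S \<and> x \<in> S \<and> y \<in> S \<and> S \<subseteq> B"
    if xy: "x \<in> B" "y \<in> B" for x y
  proof -
    \<comment> \<open>The segment from \<open>x\<close> to \<open>y\<close>. Points are sequences
      that vanish from index \<open>n\<close> on, so lying in the ball needs both the norm estimate,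
      which is convexity, and the vanishing of the remaining coordinates.\<close>
    define l where "l = (\<lambda>t i. (1 - t) * x i + t * y i :: real)"
    have lB: "l t \<in> B" if t: "t \<in> {0..1}" for t
    proof -
      have "L2_set (\<lambda>i. l t i - c i) {..<n}
          = L2_set (\<lambda>i. (1 - t) * (x i - c i) + t * (y i - c i)) {..<n}"
        by (intro arg_cong2[where f = L2_set]) (auto simp: l_def algebra_simps)
      also have "\<dots> \<le> L2_set (\<lambda>i. (1 - t) * (x i - c i)) {..<n}
          + L2_set (\<lambda>i. t * (y i - c i)) {..<n}"
        by (rule L2_set_triangle_ineq)
      also have "\<dots> = (1 - t) * L2_set (\<lambda>i. x i - c i) {..<n} + t * L2_set (\<lambda>i. y i - c i) {..<n}"
        using t by (simp add: L2_set_right_distrib)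
      also have "\<dots> < r"
        using xy t unfolding B by (intro convex_bound_lt) auto
      finally show ?thesis
        using xy unfolding B by (auto simp: topspace_Euclidean_space l_def)
    qed
    have "continuous_map (top_of_set {0..1}) (Euclidean_space n) l"
      unfolding Euclidean_space_def continuous_map_in_subtopology
    proof
      show "continuous_map (top_of_set {0..1}) (powertop_real UNIV) l"
        unfolding continuous_map_componentwise_UNIV l_def
        by (auto intro!: continuous_intros)
      show "l \<in> topspace (top_of_set {0..1}) \<rightarrow> {x. \<forall>i\<ge>n. x i = 0}"
        using lB unfolding B by (auto simp: topspace_Euclidean_space)
    qed
    then have "connectedin (Euclidean_space n) (l ` {0..1})"
      by (rule connectedin_continuous_map_image) (simp add: connectedin_subtopology)
    moreover have "x \<in> l ` {0..1}" "y \<in> l ` {0..1}"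
      by (auto simp: l_def intro: image_eqI[of _ _ 0] image_eqI[of _ _ 1])
    ultimately show ?thesis using lB by (intro exI[of _ "l ` {0..1}"]) auto
  qed
  then have "connected_space (subtopology (Euclidean_space n) B)"
    unfolding connected_space_subconnected connectedin_subtopology topspace_subtopology
    by (meson IntD2)
  then show ?thesis
    using B by (auto simp: connectedin_def)
qed

section \<open>Charts, plaques and the carrier of the leaf topology\<close>

lemma is_chart_homeomorphic_maps:
  assumes "is_chart n X c"
  obtains g where
    "homeomorphic_maps (subtopology X (cdom c))
       (prod_topology (subtopology (Euclidean_space n) (cball c)) (ctrans c)) (cmap c) g"
    "cdom c \<subseteq> topspace X"
    "topspace (subtopology (Euclidean_space n) (cball c)) = cball c"
  using assms openin_subset unfolding is_chart_def homeomorphic_map_maps Euclidean_open_ball_def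
  by fastforce

text \<open>\<open>cmap c\<close> sends all of \<open>cdom c\<close> into the ball times the
  transversal, so the ball condition in \<open>chart_plaques\<close> holds automatically and plaques
  become fibres of the transverse coordinate \<open>snd (cmap c q)\<close>.\<close>

lemma in_chart_plaque_iff:
  assumes "is_chart n X c"
  shows "P \<in> chart_plaques c \<longleftrightarrow>
    (\<exists>z \<in> topspace (ctrans c). P = {q \<in> cdom c. snd (cmap c q) = z})"
proof -
  obtain g where g: "homeomorphic_maps (subtopology X (cdom c))
       (prod_topology (subtopology (Euclidean_space n) (cball c)) (ctrans c)) (cmap c) g"
    "cdom c \<subseteq> topspace X"
    "topspace (subtopology (Euclidean_space n) (cball c)) = cball c"
    by (rule is_chart_homeomorphic_maps[OF assms])
  have "fst (cmap c q) \<in> cball c" if "q \<in> cdom c" for q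
    using that g continuous_map_image_subset_topspace[of "subtopology X (cdom c)"]
    unfolding homeomorphic_maps_def by (fastforce simp: mem_Times_iff)
  then have "{q \<in> cdom c. cmap c q \<in> cball c \<times> {z}} = {q \<in> cdom c. snd (cmap c q) = z}" for z
    by (auto simp: mem_Times_iff)
  then show ?thesis by (auto simp: chart_plaques_def)
qed

lemma chart_plaque_exists:
  assumes "is_chart n X c" "q \<in> cdom c"
  shows "\<exists>P \<in> chart_plaques c. q \<in> P"
proof -
  obtain g where g: "homeomorphic_maps (subtopology X (cdom c))
       (prod_topology (subtopology (Euclidean_space n) (cball c)) (ctrans c)) (cmap c) g"
    "cdom c \<subseteq> topspace X"
    by (rule is_chart_homeomorphic_maps[OF assms(1)])
  have "snd (cmap c q) \<in> topspace (ctrans c)"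
    using assms(2) g continuous_map_image_subset_topspace[of "subtopology X (cdom c)"]
    unfolding homeomorphic_maps_def by (fastforce simp: mem_Times_iff)
  then have "{p \<in> cdom c. snd (cmap c p) = snd (cmap c q)} \<in> chart_plaques c"
    using in_chart_plaque_iff[OF assms(1)] by blast
  then show ?thesis by (rule bexI[rotated]) (simp add: assms(2))
qed

lemma openin_leaf_topology_plaque:
  assumes "c \<in> foliated_charts n X F" "P \<in> chart_plaques c"
  shows "openin (leaf_topology n X F) P"
  using assms unfolding leaf_topology_def by (auto intro: topology_generated_by_Basis)

lemma regular_foliated_atlas_chart_exists:
  assumes "regular_foliated_atlas n X F \<U>" "x \<in> topspace X"
  obtains c where "c \<in> \<U>" "x \<in> cdom c" "is_chart n X c" "c \<in> foliated_charts n X F"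
proof -
  have "foliated_atlas n X \<U>" "\<U> \<subseteq> foliated_charts n X F"
    using assms(1) by (simp_all add: regular_foliated_atlas_def)
  then show ?thesis
    using assms(2) that unfolding foliated_atlas_def by blast
qed

lemma topspace_leaf_topology:
  assumes "regular_foliated_atlas n X F \<U>"
  shows "topspace (leaf_topology n X F) = topspace X"
proof
  show "topspace (leaf_topology n X F) \<subseteq> topspace X"
    unfolding leaf_topology_def topology_generated_by_topspace foliated_charts_def
      chart_plaques_def is_chart_def
    by (auto dest: openin_subset)
  show "topspace X \<subseteq> topspace (leaf_topology n X F)"
  proof
    fix x assume "x \<in> topspace X"
    then obtain c where "c \<in> \<U>" "x \<in> cdom c" "is_chart n X c" "c \<in> foliated_charts n X F"
      using assms regular_foliated_atlas_chart_exists by metis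
    then show "x \<in> topspace (leaf_topology n X F)"
      by (meson chart_plaque_exists openin_leaf_topology_plaque openin_subset subsetD)
  qed
qed

section \<open>Transverse coordinate changes and connectedness of plaques\<close>

text \<open>Plaques being fibres of the transverse coordinate, comparing plaques of two charts takes
  only the component \<open>h\<close> of the coordinate change; the leafwise component is
  dropped.\<close>

lemma coord_change_ok_transverse:
  assumes "coord_change_ok X c c'" "q \<in> cdom c" "q \<in> cdom c'"
  obtains W h where "openin X W" "q \<in> W" "W \<subseteq> cdom c \<inter> cdom c'"
    "\<And>p. p \<in> W \<Longrightarrow> snd (cmap c' p) = h (snd (cmap c p))"
proof -
  let ?P = "\<lambda>W x' h. openin X W \<and> q \<in> W \<and> W \<subseteq> cdom c \<inter> cdom c' \<and>
        (\<forall>p\<in>W. \<forall>x z. cmap c p = (x, z) \<longrightarrow> cmap c' p = (x' (x, z), h z))"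
  have "\<exists>W x' h. ?P W x' h"
    using bspec[OF assms(1)[unfolded coord_change_ok_def], of q] assms(2,3) by simp
  then obtain W where "\<exists>x' h. ?P W x' h" ..
  then obtain x' where "\<exists>h. ?P W x' h" ..
  then obtain h where "?P W x' h" ..
  then have W: "openin X W" "q \<in> W" "W \<subseteq> cdom c \<inter> cdom c'"
    and h: "\<forall>p\<in>W. \<forall>x z. cmap c p = (x, z) \<longrightarrow> cmap c' p = (x' (x, z), h z)"
    by simp_all
  have "snd (cmap c' p) = h (snd (cmap c p))" if "p \<in> W" for p
    using h[rule_format, OF that, of "fst (cmap c p)" "snd (cmap c p)"] by simp
  then show thesis using that W by blast
qed

text \<open>
  Two foliated charts are only assumed compatible with the charts of \<open>F\<close>; the coordinate change
  between them is composed through a chart of \<open>F\<close>.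
\<close>

lemma foliated_charts_transverse_change:
  assumes F: "foliated_atlas n X F"
    and c: "c \<in> foliated_charts n X F" "c' \<in> foliated_charts n X F"
    and q: "q \<in> cdom c" "q \<in> cdom c'"
  obtains W h where "openin X W" "q \<in> W" "W \<subseteq> cdom c \<inter> cdom c'"
    "\<And>p. p \<in> W \<Longrightarrow> snd (cmap c' p) = h (snd (cmap c p))"
proof -
  have "q \<in> topspace X"
    using c q openin_subset unfolding foliated_charts_def is_chart_def by blast
  then obtain a where a: "a \<in> F" "q \<in> cdom a"
    using F unfolding foliated_atlas_def by blast
  have ca: "coord_change_ok X c a" "coord_change_ok X a c'"
    using a c unfolding foliated_charts_def by auto
  obtain W1 h1 where W1: "openin X W1" "q \<in> W1" "W1 \<subseteq> cdom c \<inter> cdom a"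
      "\<And>p. p \<in> W1 \<Longrightarrow> snd (cmap a p) = h1 (snd (cmap c p))"
    using coord_change_ok_transverse[OF ca(1) q(1) a(2)] by blast
  obtain W2 h2 where W2: "openin X W2" "q \<in> W2" "W2 \<subseteq> cdom a \<inter> cdom c'"
      "\<And>p. p \<in> W2 \<Longrightarrow> snd (cmap c' p) = h2 (snd (cmap a p))"
    using coord_change_ok_transverse[OF ca(2) a(2) q(2)] by blast
  show thesis
  proof
    show "openin X (W1 \<inter> W2)" "q \<in> W1 \<inter> W2" "W1 \<inter> W2 \<subseteq> cdom c \<inter> cdom c'"
      using W1 W2 by auto
    show "snd (cmap c' p) = (h2 \<circ> h1) (snd (cmap c p))" if "p \<in> W1 \<inter> W2" for p
      using W1(4) W2(4) that by simp
  qed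
qed

text \<open>The plaque is the image of a ball under the section \<open>s\<close> with fixed
  transverse coordinate \<open>z\<close>. Continuity of \<open>s\<close> into \<open>X\<close> does
  not by itself give continuity into the leaf topology, where plaques are open; this is checked on
  the generating plaques \<open>Q\<close>. Along \<open>s\<close> the transverse coordinate of any
  other foliated chart is locally a function of \<open>z\<close> alone, hence constant, so
  \<open>s\<close> cannot leave \<open>Q\<close> locally.\<close>

lemma connectedin_leaf_topology_plaque:
  assumes F: "foliated_atlas n X F"
    and c: "c \<in> foliated_charts n X F" and P: "P \<in> chart_plaques c"
  shows "connectedin (leaf_topology n X F) P"
proof -
  have ch: "is_chart n X c" using c by (simp add: foliated_charts_def)
  define B where "B = subtopology (Euclidean_space n) (cball c)"
  obtain g where g: "homeomorphic_maps (subtopology X (cdom c))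
       (prod_topology B (ctrans c)) (cmap c) g"
    and dom: "cdom c \<subseteq> topspace X" and tB: "topspace B = cball c"
    unfolding B_def by (rule is_chart_homeomorphic_maps[OF ch])
  obtain z where z: "z \<in> topspace (ctrans c)" and Pz: "P = {q \<in> cdom c. snd (cmap c q) = z}"
    using P in_chart_plaque_iff[OF ch] by blast
  define s where "s b = g (b, z)" for b
  have "continuous_map B (prod_topology B (ctrans c)) (\<lambda>b. (b, z))"
    using z by (auto intro: continuous_intros)
  then have "continuous_map B (subtopology X (cdom c)) s"
    using g continuous_map_compose[of B _ "\<lambda>b. (b, z)" _ g]
    unfolding homeomorphic_maps_def s_def o_def by blast
  then have s: "continuous_map B X s" and sdom: "\<And>b. b \<in> cball c \<Longrightarrow> s b \<in> cdom c"
    using tB by (auto simp: continuous_map_in_subtopology)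
  have cs: "cmap c (s b) = (b, z)" if "b \<in> cball c" for b
    using g z that tB unfolding homeomorphic_maps_def s_def by simp
  have sP: "s ` cball c = P"
  proof
    show "s ` cball c \<subseteq> P" using sdom cs Pz by auto
    show "P \<subseteq> s ` cball c"
    proof
      fix q assume q: "q \<in> P"
      have "q \<in> topspace (subtopology X (cdom c))" using q Pz dom by auto
      then have "g (cmap c q) = q" "cmap c q \<in> topspace (prod_topology B (ctrans c))"
        using g continuous_map_image_subset_topspace unfolding homeomorphic_maps_def by blast+
      then have "q = s (fst (cmap c q))" "fst (cmap c q) \<in> cball c"
        using q Pz tB by (auto simp: s_def mem_Times_iff)
      then show "q \<in> s ` cball c" by blast
    qed
  qed
  have "continuous_map B (leaf_topology n X F) s"
    unfolding leaf_topology_def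
  proof (rule continuous_on_generated_topo)
    show "s ` topspace B \<subseteq> \<Union> (\<Union> (chart_plaques ` foliated_charts n X F))"
      using sP tB P c by blast
    fix Q assume "Q \<in> \<Union> (chart_plaques ` foliated_charts n X F)"
    then obtain c' where c': "c' \<in> foliated_charts n X F" and Q: "Q \<in> chart_plaques c'"
      by blast
    obtain z' where Qz: "Q = {q \<in> cdom c'. snd (cmap c' q) = z'}"
      using Q c' in_chart_plaque_iff unfolding foliated_charts_def by blast
    show "openin B (s -` Q \<inter> topspace B)"
    proof (subst openin_subopen, intro ballI)
      fix b assume b: "b \<in> s -` Q \<inter> topspace B"
      have "s b \<in> cdom c" "s b \<in> cdom c'" using b sdom tB Qz by auto
      then obtain W h where W: "openin X W" "s b \<in> W" "W \<subseteq> cdom c \<inter> cdom c'"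
        "\<And>p. p \<in> W \<Longrightarrow> snd (cmap c' p) = h (snd (cmap c p))"
        using foliated_charts_transverse_change[OF F c c'] by metis
      \<comment> \<open>Evaluation at \<open>s b\<close>, which lies in both plaques, identifies the
        constant.\<close>
      have "h z = z'"
        using W(4)[OF W(2)] b cs tB Qz by auto
      then have "{b' \<in> topspace B. s b' \<in> W} \<subseteq> s -` Q \<inter> topspace B"
        using W cs tB Qz by auto
      moreover have "openin B {b' \<in> topspace B. s b' \<in> W}"
        using s W(1) by (rule openin_continuous_map_preimage)
      ultimately show "\<exists>T. openin B T \<and> b \<in> T \<and> T \<subseteq> s -` Q \<inter> topspace B"
        using b W(2) by blast
    qed
  qed
  moreover have "connectedin B (cball c)"
    using connectedin_Euclidean_open_ball ch
    unfolding B_def is_chart_def by (simp add: connectedin_subtopology)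
  ultimately show ?thesis
    using connectedin_continuous_map_image sP by blast
qed

section \<open>Plaque distance and variation\<close>

text \<open>The singleton \<open>{P}\<close> is an admissible family with one plaque, since
  \<open>P\<close> is connected in the leaf topology; for \<open>x = y\<close> the distance is 0 by
  definition.\<close>

lemma plaque_dist_le_one:
  assumes "foliated_atlas n X F" "\<U> \<subseteq> foliated_charts n X F"
    and "c \<in> \<U>" "P \<in> chart_plaques c" "x \<in> P" "y \<in> P"
  shows "plaque_dist n X F \<U> x y \<le> 1"
proof -
  have "connectedin (leaf_topology n X F) P"
    using assms connectedin_leaf_topology_plaque by blast
  then have "\<exists>\<P> \<subseteq> (\<Union>c\<in>\<U>. chart_plaques c). finite \<P> \<and> card \<P> = 1 \<and>
      connectedin (leaf_topology n X F) (\<Union>\<P>) \<and> x \<in> \<Union>\<P> \<and> y \<in> \<Union>\<P>"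
    using assms by (intro exI[of _ "{P}"]) auto
  note Least_le[of "\<lambda>k. \<exists>\<P> \<subseteq> (\<Union>c\<in>\<U>. chart_plaques c). finite \<P> \<and> card \<P> = k \<and>
      connectedin (leaf_topology n X F) (\<Union>\<P>) \<and> x \<in> \<Union>\<P> \<and> y \<in> \<Union>\<P>", OF this]
  then show ?thesis
    by (cases "x = y") (simp_all only: plaque_dist_def simp_thms if_True if_False le0)
qed

text \<open>Boundedness of \<open>f\<close> bounds the differences above; otherwise the real
  supremum in \<open>variation\<close> would give no information.\<close>

lemma dist_le_variation:
  assumes "bounded (f ` L)" "x \<in> L" "y \<in> L" "real (d x y) < R"
  shows "cmod (f x - f y) \<le> variation L d R f x"
proof -
  obtain M where M: "\<And>y. y \<in> L \<Longrightarrow> cmod (f y) \<le> M"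
    using assms(1) unfolding bounded_iff by auto
  have "cmod (f x - f y) \<le> M + M" if "y \<in> L" for y
    using norm_triangle_ineq4[of "f x" "f y"] M[OF that] M[OF assms(2)] by linarith
  then have "bdd_above ((\<lambda>y. cmod (f x - f y)) ` {y \<in> L. real (d x y) < R})"
    by (auto intro!: bdd_aboveI2)
  then show ?thesis
    unfolding variation_def using assms by (intro cSUP_upper) auto
qed

section \<open>Saturation tested on plaques\<close>

text \<open>The plaques of \<open>\<U>\<close> are open in the leaf topology and cover
  \<open>X\<close>, and by invariance each of them lies in \<open>S\<close> or misses it. Hence
  \<open>S\<close> is clopen, and no leaf, being connected, is cut by \<open>S\<close>.\<close>

lemma saturatedI_plaques:
  assumes reg: "regular_foliated_atlas n X F \<U>" and S: "S \<subseteq> topspace X"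
    and PS: "\<And>c P p q. c \<in> \<U> \<Longrightarrow> P \<in> chart_plaques c \<Longrightarrow> p \<in> P \<Longrightarrow> q \<in> P \<Longrightarrow> p \<in> S \<Longrightarrow> q \<in> S"
  shows "saturated n X F S"
proof -
  let ?Y = "leaf_topology n X F"
  have top: "topspace ?Y = topspace X" using reg by (rule topspace_leaf_topology)
  have nbhd: "\<exists>P. openin ?Y P \<and> x \<in> P \<and> (P \<subseteq> S \<or> P \<inter> S = {})" if x: "x \<in> topspace X" for x
  proof -
    obtain c where c: "c \<in> \<U>" "x \<in> cdom c" "is_chart n X c" "c \<in> foliated_charts n X F"
      using regular_foliated_atlas_chart_exists[OF reg x] .
    obtain P where P: "P \<in> chart_plaques c" "x \<in> P"
      using chart_plaque_exists[OF c(3,2)] by blast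
    then have "P \<subseteq> S \<or> P \<inter> S = {}" using PS c(1) by blast
    then show ?thesis using openin_leaf_topology_plaque[OF c(4) P(1)] P(2) by blast
  qed
  have "openin ?Y S"
    by (subst openin_subopen) (use nbhd S in blast)
  moreover have "openin ?Y (topspace X - S)"
  proof (subst openin_subopen, intro ballI)
    fix x assume x: "x \<in> topspace X - S"
    then obtain P where P: "openin ?Y P" "x \<in> P" "P \<inter> S = {}" using nbhd by blast
    then show "\<exists>T. openin ?Y T \<and> x \<in> T \<and> T \<subseteq> topspace X - S"
      using openin_subset[OF P(1)] top by blast
  qed
  then have "closedin ?Y S" using S top by (simp add: closedin_def)
  ultimately have cases: "C \<subseteq> S \<or> disjnt C S" if "C \<in> leaves n X F" for C
    using that connectedin_clopen_cases connectedin_connected_components_of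
    unfolding leaves_def by blast
  have "topspace X = \<Union> (leaves n X F)"
    unfolding leaves_def Union_connected_components_of top ..
  have "S \<subseteq> \<Union> {C \<in> leaves n X F. C \<subseteq> S}"
  proof
    fix x assume x: "x \<in> S"
    then obtain C where "C \<in> leaves n X F" "x \<in> C"
      using S \<open>topspace X = \<Union> (leaves n X F)\<close> by blast
    then show "x \<in> \<Union> {C \<in> leaves n X F. C \<subseteq> S}"
      using cases x by (auto simp: disjnt_iff)
  qed
  then have "S = \<Union> {C \<in> leaves n X F. C \<subseteq> S}" by blast
  moreover have "{C \<in> leaves n X F. C \<subseteq> S} \<subseteq> leaves n X F" by blast
  ultimately show ?thesis unfolding saturated_def by (intro exI conjI)
qed

section \<open>Restriction of functions to the leaf, and sliding along plaques\<close>

text \<open>Composing \<open>f\<close> with the map \<open>\<pi>\<close> from \<open>N\<close> to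
  \<open>K\<close> extends the restriction of \<open>f\<close> continuously to \<open>N\<close>, and
  functions with such an extension are Higson. Values are made complex because the algebra of
  \<open>N\<close> is.\<close>

lemma Higson_function_restriction:
  assumes "Higson_compactification T d N j" "compactification_le T K i N j"
    and f: "continuous_map K euclideanreal f"
  shows "Higson_function T d (\<lambda>x. complex_of_real (f (i x)))"
proof -
  obtain \<pi> where \<pi>: "continuous_map N K \<pi>" "\<And>x. x \<in> topspace T \<Longrightarrow> \<pi> (j x) = i x"
    using assms(2) unfolding compactification_le_def by blast
  have "continuous_map N euclidean (\<lambda>x. complex_of_real (f (\<pi> x)))"
    using continuous_map_compose[OF continuous_map_compose[OF \<pi>(1) f], of euclidean complex_of_real]
    by (simp add: o_def continuous_on_of_real_id)
  then have "\<exists>g. continuous_map N euclidean g \<and>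
      (\<forall>x\<in>topspace T. g (j x) = complex_of_real (f (i x)))"
    using \<pi>(2) by (intro exI[of _ "\<lambda>x. complex_of_real (f (\<pi> x))"]) auto
  then show ?thesis
    using assms(1) unfolding Higson_compactification_def by blast
qed

text \<open>In chart coordinates, replacing the ball coordinate by that of \<open>q\<close> moves
  every point within its own plaque. This map is continuous and sends \<open>p\<close> to
  \<open>q\<close>, so \<open>H\<close> can be the preimage of \<open>G\<close>.\<close>

lemma plaque_slide:
  assumes ch: "is_chart n X c" and P: "P \<in> chart_plaques c" "p \<in> P" "q \<in> P"
    and G: "openin X G" "q \<in> G"
  obtains H where "openin X H" "p \<in> H"
    "\<And>x. x \<in> H \<Longrightarrow> \<exists>Q \<in> chart_plaques c. \<exists>y \<in> G. x \<in> Q \<and> y \<in> Q"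
proof -
  define B where "B = subtopology (Euclidean_space n) (cball c)"
  obtain g where g: "homeomorphic_maps (subtopology X (cdom c))
       (prod_topology B (ctrans c)) (cmap c) g"
    and dom: "cdom c \<subseteq> topspace X" and tB: "topspace B = cball c"
    unfolding B_def by (rule is_chart_homeomorphic_maps[OF ch])
  have open_dom: "openin X (cdom c)" using ch by (simp add: is_chart_def)
  obtain z where z: "z \<in> topspace (ctrans c)" and Pz: "P = {q \<in> cdom c. snd (cmap c q) = z}"
    using P in_chart_plaque_iff[OF ch] by blast
  define b where "b = fst (cmap c q)"
  have q: "cmap c q = (b, z)" "q \<in> cdom c" using P Pz by (auto simp: b_def prod_eq_iff)
  have cin: "cmap c x \<in> cball c \<times> topspace (ctrans c)" if "x \<in> cdom c" for x
    using g dom that tB continuous_map_image_subset_topspace[of "subtopology X (cdom c)"]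
    unfolding homeomorphic_maps_def by fastforce
  have gc: "g (cmap c x) = x" if "x \<in> cdom c" for x
    using g dom that unfolding homeomorphic_maps_def by auto
  have cg: "cmap c (g u) = u" "g u \<in> cdom c" if "u \<in> cball c \<times> topspace (ctrans c)" for u
    using g that tB continuous_map_image_subset_topspace[of _ "subtopology X (cdom c)" g]
    unfolding homeomorphic_maps_def by fastforce+
  have b: "b \<in> cball c" using cin[OF q(2)] q by auto
  have tr: "continuous_map (subtopology X (cdom c)) (ctrans c) (\<lambda>x. snd (cmap c x))"
    using g unfolding homeomorphic_maps_def continuous_map_pairwise by (simp add: o_def)
  then have "continuous_map (subtopology X (cdom c)) (prod_topology B (ctrans c))
      (\<lambda>x. (b, snd (cmap c x)))"
    using b tB by (auto intro: continuous_intros)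
  then have "continuous_map (subtopology X (cdom c)) (subtopology X (cdom c))
      (\<lambda>x. g (b, snd (cmap c x)))"
    using g continuous_map_compose[of _ "prod_topology B (ctrans c)" "\<lambda>x. (b, snd (cmap c x))" _ g]
    unfolding homeomorphic_maps_def o_def by blast
  then have cont: "continuous_map (subtopology X (cdom c)) X (\<lambda>x. g (b, snd (cmap c x)))"
    by (simp add: continuous_map_in_subtopology)
  define H where "H = {x \<in> topspace (subtopology X (cdom c)). g (b, snd (cmap c x)) \<in> G}"
  show thesis
  proof
    have "openin (subtopology X (cdom c)) H"
      unfolding H_def using cont G(1) by (rule openin_continuous_map_preimage)
    then show "openin X H" using open_dom by (rule openin_trans_full)
    show "p \<in> H"
      using P Pz dom G(2) gc[OF q(2)] q by (auto simp: H_def)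
    fix x assume "x \<in> H"
    then have x: "x \<in> cdom c" "g (b, snd (cmap c x)) \<in> G" by (auto simp: H_def)
    define y where "y = g (b, snd (cmap c x))"
    obtain Q where Q: "Q \<in> chart_plaques c" "x \<in> Q" using chart_plaque_exists[OF ch x(1)] by blast
    have "(b, snd (cmap c x)) \<in> cball c \<times> topspace (ctrans c)"
      using b cin[OF x(1)] by (auto simp: mem_Times_iff)
    then have "y \<in> cdom c" "snd (cmap c y) = snd (cmap c x)" using cg by (auto simp: y_def)
    then have "y \<in> Q" using Q in_chart_plaque_iff[OF ch] by auto
    then show "\<exists>Q \<in> chart_plaques c. \<exists>y \<in> G. x \<in> Q \<and> y \<in> Q"
      using Q x(2) y_def by blast
  qed
qed

section \<open>Invariance of limit sets under plaques\<close>

theorem theorem1p14: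
  fixes n :: nat
    and X :: "'a topology"
    and F \<U> :: "('a, 'z) fol_chart set"
    and L :: "'a set"
    and K :: "'k topology" and i :: "'a \<Rightarrow> 'k"
    and N :: "'m topology" and j :: "'a \<Rightarrow> 'm"
  assumes "compact_Polish_foliated_space n X F"
    and "regular_foliated_atlas n X F \<U>"
    and "L \<in> leaves n X F"
    and "compactification (leaf_space n X F L) K i"
    and "Higson_compactification (leaf_space n X F L) (plaque_dist n X F \<U>) N j"
    and "compactification_le (leaf_space n X F L) K i N j"
  shows "\<forall>e \<in> corona (leaf_space n X F L) K i. saturated n X F (limit_set X L K i e)"
proof
  let ?T = "leaf_space n X F L" and ?d = "plaque_dist n X F \<U>"
  fix e assume e: "e \<in> corona ?T K i"
  have F: "foliated_atlas n X F"
    using assms(1) by (simp add: compact_Polish_foliated_space_def)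
  have \<U>: "\<U> \<subseteq> foliated_charts n X F"
    using assms(2) by (simp add: regular_foliated_atlas_def)
  have T: "topspace ?T = L"
    using assms(3) connected_components_of_subset
    unfolding leaf_space_def leaves_def by fastforce
  have K: "compact_space K" "Hausdorff_space K" "continuous_map ?T K i"
    using assms(4) by (auto simp: compactification_def embedding_map_def continuous_map_in_subtopology
        dest!: homeomorphic_imp_continuous_map)
  have eK: "e \<in> topspace K" "e \<notin> i ` L"
    using e T by (auto simp: corona_def)
  show "saturated n X F (limit_set X L K i e)"
  proof (rule saturatedI_plaques[OF assms(2)])
    show "limit_set X L K i e \<subseteq> topspace X"
    proof -
      \<comment> \<open>The whole of \<open>topspace K\<close> is one of the neighborhoods of
        \<open>e\<close> being intersected.\<close>
      have "limit_set X L K i e \<subseteq> X closure_of {x \<in> L. i x \<in> topspace K}"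
        unfolding limit_set_def using eK by (intro INF_lower) auto
      then show ?thesis using closure_of_subset_topspace by fast
    qed
    fix c P p q
    assume c: "c \<in> \<U>" and P: "P \<in> chart_plaques c" "p \<in> P" "q \<in> P"
      and p: "p \<in> limit_set X L K i e"
    have ch: "is_chart n X c" using c \<U> by (auto simp: foliated_charts_def)
    have qX: "q \<in> topspace X"
      using P ch openin_subset unfolding is_chart_def chart_plaques_def by fast
    have "q \<in> X closure_of {x \<in> L. i x \<in> V}"
      if V: "V \<subseteq> topspace K" "openin K W" "e \<in> W" "W \<subseteq> V" for V W
      unfolding in_closure_of
    proof (intro conjI qX allI impI)
      fix G assume G: "q \<in> G \<and> openin X G"
      have "completely_regular_space K"
        using K by (simp add: compact_Hausdorff_or_regular_imp_normal_space
            normal_imp_completely_regular_space)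
      moreover have "closedin K (topspace K - W)" "e \<in> topspace K - (topspace K - W)"
        using V(2,3) eK(1) by auto
      ultimately obtain f where f: "continuous_map K (top_of_set {0..1::real}) f" "f e = 0"
        "f ` (topspace K - W) \<subseteq> {1}"
        unfolding completely_regular_space_def by meson
      have fK: "continuous_map K euclideanreal f"
        using f(1) by (simp add: continuous_map_in_subtopology)
      define u where "u x = complex_of_real (f (i x))" for x
      have "Higson_function ?T ?d u"
        unfolding u_def using Higson_function_restriction[OF assms(5,6) fK] .
      \<comment> \<open>Radius 2 is chosen because \<open>variation\<close> uses a strict inequality
        and points of one plaque may be at distance 1.\<close>
      then have bd: "bounded (u ` L)" and "vanishes_at_infinity ?T (variation L ?d 2 u)"
        unfolding Higson_function_def T by auto
      then obtain C where C: "compactin ?T C"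
        "\<And>x. x \<in> L - C \<Longrightarrow> \<bar>variation L ?d 2 u x\<bar> < 1/2"
        unfolding vanishes_at_infinity_def T by (metis half_gt_zero zero_less_one)
      \<comment> \<open>The image of \<open>C\<close> must be closed for its removal to leave an
        open set.\<close>
      have "closedin K (i ` C)"
        using image_compactin[OF C(1) K(3)] K(2) compactin_imp_closedin by blast
      moreover have "openin K {k \<in> topspace K. f k \<in> {..<1/2}}"
        using fK by (rule openin_continuous_map_preimage) simp
      ultimately have op: "openin K ({k \<in> topspace K. f k \<in> {..<1/2}} - i ` C)"
        by blast
      \<comment> \<open>Here \<open>f\<close> is below \<open>1/2\<close> and leaf points avoid
        \<open>C\<close>. The point \<open>e\<close> survives the removal because it is in the
        corona, while \<open>C\<close> is mapped into the image of \<open>L\<close>.\<close>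
      define V' where "V' = {k \<in> topspace K. f k \<in> {..<1/2}} - i ` C"
      have CL: "C \<subseteq> L" using compactin_subset_topspace[OF C(1)] T by simp
      have "e \<in> V'" using eK f(2) CL by (auto simp: V'_def)
      then have "V' \<in> {V. V \<subseteq> topspace K \<and> (\<exists>W. openin K W \<and> e \<in> W \<and> W \<subseteq> V)}"
        using op unfolding V'_def by blast
      then have pV': "p \<in> X closure_of {x \<in> L. i x \<in> V'}"
        using p unfolding limit_set_def by blast
      obtain H where H: "openin X H" "p \<in> H"
        "\<And>x. x \<in> H \<Longrightarrow> \<exists>Q \<in> chart_plaques c. \<exists>y \<in> G. x \<in> Q \<and> y \<in> Q"
        using plaque_slide[OF ch P] G by metis
      obtain x where x: "x \<in> L" "i x \<in> V'" "x \<in> H"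
        using pV' H(1,2) unfolding in_closure_of by blast
      then obtain Q y where Q: "Q \<in> chart_plaques c" "x \<in> Q" "y \<in> Q" and y: "y \<in> G"
        using H(3) by blast
      have "connectedin (leaf_topology n X F) Q"
        using connectedin_leaf_topology_plaque F \<U> c Q(1) by blast
      \<comment> \<open>A connected component contains every connected set that meets it.\<close>
      then have "Q \<subseteq> L"
        using assms(3) x(1) Q(2) unfolding leaves_def
        by (intro connected_components_of_maximal) (auto simp: disjnt_iff)
      then have yL: "y \<in> L" using Q by blast
      have "?d x y \<le> 1" using plaque_dist_le_one[OF F \<U> c Q] .
      then have "cmod (u x - u y) \<le> variation L ?d 2 u x"
        using dist_le_variation[OF bd x(1) yL] by simp
      also have "\<dots> < 1/2" using C(2)[of x] x by (force simp: V'_def)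
      finally have "\<bar>f (i x) - f (i y)\<bar> < 1/2"
        by (simp add: u_def flip: of_real_diff)
      moreover have "f (i x) < 1/2" using x(2) by (simp add: V'_def)
      \<comment> \<open>The two strict bounds by \<open>1/2\<close> add up to 1, the value of
        \<open>f\<close> off \<open>W\<close>, so \<open>i y\<close> is forced into
        \<open>W\<close>.\<close>
      ultimately have "f (i y) < 1" by linarith
      moreover have "i y \<in> topspace K"
        using K(3) yL T continuous_map_image_subset_topspace by blast
      ultimately have "i y \<in> W" using f(3) by force
      then show "\<exists>y. y \<in> {x \<in> L. i x \<in> V} \<and> y \<in> G"
        using V(4) yL y by blast
    qed
    then show "q \<in> limit_set X L K i e"
      unfolding limit_set_def by blast
  qed
qed

end
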